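(* Let $R$ be a local ring. Then the right $R$-module $R_R$ is pure extending.
   Context: Rings are associative with unity (not necessarily commutative) and modules are unital right modules. A submodule $P$ of a right $R$-module $M$ is pure in $M$ if for every left $R$-module $N$ the induced map $P\otimes_R N\to M\otimes_R N$ is injective. A submodule $N$ of $L$ is essential in $L$ if $N\cap X\neq 0$ for every nonzero submodule $X$ of $L$. An $R$-module $M$ is pure extending if every pure submodule of $M$ is essential in some direct summand of $M$. *)

theory Defs
  imports "HOL-Algebra.Module" "HOL-Algebra.AbelCoset" "HOL-Algebra.Free_Abelian_Groups"
begin

section \<open>One-sided modules over a not necessarily commutative ring\<close>

text \<open>
  The library locale \<open>module\<close> requires a commutative ring, so one-sided modules get their own
  locales on the same record type. In a right module, \<open>a \<odot> x\<close> is read as \<open>x \<cdot> a\<close>; left and right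
  modules thus differ only in the associativity law. The ring multiplication and unit fields of the
  module record are ignored. The library predicate \<open>submodule\<close> does not assume commutativity
  and serves for both sides.
\<close>

locale left_module = R?: ring R + M?: abelian_group M
  for R :: "('a, 'c) ring_scheme" (structure) and M :: "('a, 'm, 'd) module_scheme" (structure) +
  assumes smult_closed [simp, intro]:
      "\<lbrakk>a \<in> carrier R; x \<in> carrier M\<rbrakk> \<Longrightarrow> a \<odot>\<^bsub>M\<^esub> x \<in> carrier M"
    and smult_l_distr:
      "\<lbrakk>a \<in> carrier R; b \<in> carrier R; x \<in> carrier M\<rbrakk> \<Longrightarrow>
        (a \<oplus>\<^bsub>R\<^esub> b) \<odot>\<^bsub>M\<^esub> x = a \<odot>\<^bsub>M\<^esub> x \<oplus>\<^bsub>M\<^esub> b \<odot>\<^bsub>M\<^esub> x"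
    and smult_r_distr:
      "\<lbrakk>a \<in> carrier R; x \<in> carrier M; y \<in> carrier M\<rbrakk> \<Longrightarrow>
        a \<odot>\<^bsub>M\<^esub> (x \<oplus>\<^bsub>M\<^esub> y) = a \<odot>\<^bsub>M\<^esub> x \<oplus>\<^bsub>M\<^esub> a \<odot>\<^bsub>M\<^esub> y"
    and smult_assoc:
      "\<lbrakk>a \<in> carrier R; b \<in> carrier R; x \<in> carrier M\<rbrakk> \<Longrightarrow>
        (a \<otimes>\<^bsub>R\<^esub> b) \<odot>\<^bsub>M\<^esub> x = a \<odot>\<^bsub>M\<^esub> (b \<odot>\<^bsub>M\<^esub> x)"
    and smult_one [simp]: "x \<in> carrier M \<Longrightarrow> \<one>\<^bsub>R\<^esub> \<odot>\<^bsub>M\<^esub> x = x"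

locale right_module = R?: ring R + M?: abelian_group M
  for R :: "('a, 'c) ring_scheme" (structure) and M :: "('a, 'm, 'd) module_scheme" (structure) +
  assumes smult_closed [simp, intro]:
      "\<lbrakk>a \<in> carrier R; x \<in> carrier M\<rbrakk> \<Longrightarrow> a \<odot>\<^bsub>M\<^esub> x \<in> carrier M"
    and smult_l_distr:
      "\<lbrakk>a \<in> carrier R; b \<in> carrier R; x \<in> carrier M\<rbrakk> \<Longrightarrow>
        (a \<oplus>\<^bsub>R\<^esub> b) \<odot>\<^bsub>M\<^esub> x = a \<odot>\<^bsub>M\<^esub> x \<oplus>\<^bsub>M\<^esub> b \<odot>\<^bsub>M\<^esub> x"
    and smult_r_distr:
      "\<lbrakk>a \<in> carrier R; x \<in> carrier M; y \<in> carrier M\<rbrakk> \<Longrightarrow>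
        a \<odot>\<^bsub>M\<^esub> (x \<oplus>\<^bsub>M\<^esub> y) = a \<odot>\<^bsub>M\<^esub> x \<oplus>\<^bsub>M\<^esub> a \<odot>\<^bsub>M\<^esub> y"
    and smult_assoc:
      "\<lbrakk>a \<in> carrier R; b \<in> carrier R; x \<in> carrier M\<rbrakk> \<Longrightarrow>
        (a \<otimes>\<^bsub>R\<^esub> b) \<odot>\<^bsub>M\<^esub> x = b \<odot>\<^bsub>M\<^esub> (a \<odot>\<^bsub>M\<^esub> x)"
    and smult_one [simp]: "x \<in> carrier M \<Longrightarrow> \<one>\<^bsub>R\<^esub> \<odot>\<^bsub>M\<^esub> x = x"

definition right_regular :: "('a, 'c) ring_scheme \<Rightarrow> ('a, 'a) module" where
  "right_regular R = \<lparr>carrier = carrier R, monoid.mult = monoid.mult R, one = one R,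
     ring.zero = ring.zero R, add = add R, smult = (\<lambda>a x. x \<otimes>\<^bsub>R\<^esub> a)\<rparr>"

lemma right_regular_simps [simp]:
  "carrier (right_regular R) = carrier R"
  "\<zero>\<^bsub>right_regular R\<^esub> = \<zero>\<^bsub>R\<^esub>"
  "x \<oplus>\<^bsub>right_regular R\<^esub> y = x \<oplus>\<^bsub>R\<^esub> y"
  "a \<odot>\<^bsub>right_regular R\<^esub> x = x \<otimes>\<^bsub>R\<^esub> a"
  by (simp_all add: right_regular_def)

lemma (in ring) right_module_right_regular: "right_module R (right_regular R)"
proof (intro right_module.intro right_module_axioms.intro)
  show "ring R" by (rule ring_axioms)
  show "abelian_group (right_regular R)"
  proof (rule abelian_groupI)
    fix x assume "x \<in> carrier (right_regular R)"
    then show "\<exists>y\<in>carrier (right_regular R). y \<oplus>\<^bsub>right_regular R\<^esub> x = \<zero>\<^bsub>right_regular R\<^esub>"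
      by (auto intro!: bexI[of _ "\<ominus> x"] simp: l_neg)
  qed (auto simp: a_assoc intro: a_comm)
qed (auto simp: l_distr r_distr m_assoc)

definition maximal_right_ideal :: "'a set \<Rightarrow> ('a, 'c) ring_scheme \<Rightarrow> bool" where
  "maximal_right_ideal J R \<longleftrightarrow>
     submodule J R (right_regular R) \<and> J \<noteq> carrier R \<and>
     (\<forall>K. submodule K R (right_regular R) \<and> J \<subseteq> K \<and> K \<noteq> carrier R \<longrightarrow> K = J)"

definition local_ring :: "('a, 'c) ring_scheme \<Rightarrow> bool" where
  "local_ring R \<longleftrightarrow> ring R \<and> (\<exists>!J. maximal_right_ideal J R)"


section \<open>Tensor products over a not necessarily commutative ring\<close>

definition tensor_relators ::
  "('a, 'c) ring_scheme \<Rightarrow> ('a, 'm, 'd) module_scheme \<Rightarrow> ('a, 'n, 'e) module_scheme \<Rightarrow>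
    ('m \<times> 'n \<Rightarrow>\<^sub>0 int) set" where
  "tensor_relators R M N =
     {frag_of (x \<oplus>\<^bsub>M\<^esub> y, n) - frag_of (x, n) - frag_of (y, n) | x y n.
        x \<in> carrier M \<and> y \<in> carrier M \<and> n \<in> carrier N} \<union>
     {frag_of (x, m \<oplus>\<^bsub>N\<^esub> n) - frag_of (x, m) - frag_of (x, n) | x m n.
        x \<in> carrier M \<and> m \<in> carrier N \<and> n \<in> carrier N} \<union>
     {frag_of (a \<odot>\<^bsub>M\<^esub> x, n) - frag_of (x, a \<odot>\<^bsub>N\<^esub> n) | a x n.
        a \<in> carrier R \<and> x \<in> carrier M \<and> n \<in> carrier N}"

abbreviation tensor_free ::
  "('a, 'm, 'd) module_scheme \<Rightarrow> ('a, 'n, 'e) module_scheme \<Rightarrow> ('m \<times> 'n \<Rightarrow>\<^sub>0 int) monoid" where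
  "tensor_free M N \<equiv> free_Abelian_group (carrier M \<times> carrier N)"

definition tensor_rel ::
  "('a, 'c) ring_scheme \<Rightarrow> ('a, 'm, 'd) module_scheme \<Rightarrow> ('a, 'n, 'e) module_scheme \<Rightarrow>
    ('m \<times> 'n \<Rightarrow>\<^sub>0 int) set" where
  "tensor_rel R M N = generate (tensor_free M N) (tensor_relators R M N)"

text \<open>The abelian group \<open>M \<otimes>\<^sub>R N\<close> of a right module \<open>M\<close> and a left module \<open>N\<close>.\<close>

definition tensor_product ::
  "('a, 'c) ring_scheme \<Rightarrow> ('a, 'm, 'd) module_scheme \<Rightarrow> ('a, 'n, 'e) module_scheme \<Rightarrow>
    ('m \<times> 'n \<Rightarrow>\<^sub>0 int) set monoid" where
  "tensor_product R M N = tensor_free M N Mod tensor_rel R M N"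

definition elem_tensor ::
  "('a, 'c) ring_scheme \<Rightarrow> ('a, 'm, 'd) module_scheme \<Rightarrow> ('a, 'n, 'e) module_scheme \<Rightarrow>
    'm \<Rightarrow> 'n \<Rightarrow> ('m \<times> 'n \<Rightarrow>\<^sub>0 int) set" where
  "elem_tensor R M N x n = tensor_rel R M N #>\<^bsub>tensor_free M N\<^esub> frag_of (x, n)"

text \<open>
  For \<open>f\<close> from \<open>P\<close> to \<open>M\<close>, \<open>tensor_map R M N f\<close> is the induced map from \<open>P \<otimes>\<^sub>R N\<close> to \<open>M \<otimes>\<^sub>R N\<close>.
  On cosets it is a union over representatives, all of which give the same coset when \<open>f\<close> is
  linear; see \<open>tensor_map_elem_tensor\<close> and \<open>tensor_map_hom\<close> below.
\<close>

definition tensor_map ::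
  "('a, 'c) ring_scheme \<Rightarrow> ('a, 'm, 'd) module_scheme \<Rightarrow> ('a, 'n, 'e) module_scheme \<Rightarrow>
    ('p \<Rightarrow> 'm) \<Rightarrow> ('p \<times> 'n \<Rightarrow>\<^sub>0 int) set \<Rightarrow> ('m \<times> 'n \<Rightarrow>\<^sub>0 int) set" where
  "tensor_map R M N f X =
     \<Union> ((\<lambda>x. tensor_rel R M N #>\<^bsub>tensor_free M N\<^esub>
        frag_extend (frag_of \<circ> map_prod f id) x) ` X)"


section \<open>Pure, essential and complemented submodules\<close>

text \<open>
  HOL cannot quantify over all types inside a definition, so purity is first defined relative to
  the left modules carried by a type \<open>'n\<close>. The type \<open>(nat \<Rightarrow> 'a) set\<close> used in \<open>pure_submodule\<close>
  accommodates a copy of every finitely generated left \<open>R\<close>-module, and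
  \<open>pure_submodule_imp_wrt\<close> below shows that purity relative to it implies purity
  relative to every type.
\<close>

definition pure_submodule_wrt ::
  "'n itself \<Rightarrow> ('a, 'c) ring_scheme \<Rightarrow> 'm set \<Rightarrow> ('a, 'm, 'd) module_scheme \<Rightarrow> bool" where
  "pure_submodule_wrt _ R P M \<longleftrightarrow>
     submodule P R M \<and>
     (\<forall>N :: ('a, 'n) module. left_module R N \<longrightarrow>
        inj_on (tensor_map R M N (\<lambda>x. x))
          (carrier (tensor_product R (M\<lparr>carrier := P\<rparr>) N)))"

definition pure_submodule ::
  "('a, 'c) ring_scheme \<Rightarrow> 'm set \<Rightarrow> ('a, 'm, 'd) module_scheme \<Rightarrow> bool" where
  "pure_submodule R P M \<longleftrightarrow> pure_submodule_wrt TYPE((nat \<Rightarrow> 'a) set) R P M"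

definition essential_submodule ::
  "('a, 'c) ring_scheme \<Rightarrow> 'm set \<Rightarrow> ('a, 'm, 'd) module_scheme \<Rightarrow> bool" where
  "essential_submodule R N L \<longleftrightarrow>
     submodule N R L \<and>
     (\<forall>X. submodule X R L \<and> X \<noteq> {\<zero>\<^bsub>L\<^esub>} \<longrightarrow> N \<inter> X \<noteq> {\<zero>\<^bsub>L\<^esub>})"

definition direct_summand ::
  "('a, 'c) ring_scheme \<Rightarrow> 'm set \<Rightarrow> ('a, 'm, 'd) module_scheme \<Rightarrow> bool" where
  "direct_summand R D M \<longleftrightarrow>
     submodule D R M \<and>
     (\<exists>E. submodule E R M \<and> D \<inter> E = {\<zero>\<^bsub>M\<^esub>} \<and> D <+>\<^bsub>M\<^esub> E = carrier M)"

definition pure_extending ::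
  "('a, 'c) ring_scheme \<Rightarrow> ('a, 'm, 'd) module_scheme \<Rightarrow> bool" where
  "pure_extending R M \<longleftrightarrow>
     right_module R M \<and>
     (\<forall>P. pure_submodule R P M \<longrightarrow>
        (\<exists>D. direct_summand R D M \<and> essential_submodule R P (M\<lparr>carrier := D\<rparr>)))"


section \<open>The tensor product is well behaved\<close>

lemma tensor_relators_subset:
  assumes "right_module R M" "left_module R N"
  shows "tensor_relators R M N \<subseteq> carrier (tensor_free M N)"
proof -
  interpret M: right_module R M by fact
  interpret N: left_module R N by fact
  show ?thesis
    unfolding tensor_relators_def by (auto dest!: subsetD[OF keys_diff])
qed

lemma keys_tensor_relators:
  assumes "right_module R M" "left_module R N" "h \<in> tensor_relators R M N"
  shows "Poly_Mapping.keys h \<subseteq> carrier M \<times> carrier N"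
  using subsetD[OF tensor_relators_subset assms(3)] assms(1,2) by simp

lemma tensor_rel_subgroup:
  assumes "right_module R M" "left_module R N"
  shows "subgroup (tensor_rel R M N) (tensor_free M N)"
  unfolding tensor_rel_def
  by (intro group.generate_is_subgroup tensor_relators_subset assms) simp

lemma tensor_rel_normal:
  assumes "right_module R M" "left_module R N"
  shows "tensor_rel R M N \<lhd> tensor_free M N"
  by (simp add: comm_group.normal_iff_subgroup[OF abelian_free_Abelian_group] tensor_rel_subgroup assms)

lemma comm_group_tensor_product:
  assumes "right_module R M" "left_module R N"
  shows "comm_group (tensor_product R M N)"
  unfolding tensor_product_def
  by (intro comm_group.abelian_FactGroup abelian_free_Abelian_group tensor_rel_subgroup assms)

lemma tensor_coset_eq_iff:
  assumes "right_module R M" "left_module R N"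
    and "Poly_Mapping.keys x \<subseteq> carrier M \<times> carrier N" "Poly_Mapping.keys y \<subseteq> carrier M \<times> carrier N"
  shows "tensor_rel R M N #>\<^bsub>tensor_free M N\<^esub> x = tensor_rel R M N #>\<^bsub>tensor_free M N\<^esub> y \<longleftrightarrow>
         x - y \<in> tensor_rel R M N"
proof -
  interpret F: group "tensor_free M N" by simp
  interpret K: subgroup "tensor_rel R M N" "tensor_free M N" by (rule tensor_rel_subgroup[OF assms(1,2)])
  have "tensor_rel R M N #>\<^bsub>tensor_free M N\<^esub> x = tensor_rel R M N #>\<^bsub>tensor_free M N\<^esub> y \<longleftrightarrow>
        x \<in> tensor_rel R M N #>\<^bsub>tensor_free M N\<^esub> y"
    using F.repr_independence[OF _ _ K.subgroup_axioms] F.rcos_self[OF _ K.subgroup_axioms] assms(3,4)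
    by (metis carrier_free_Abelian_group_iff)
  also have "\<dots> \<longleftrightarrow> (\<exists>h\<in>tensor_rel R M N. x = h + y)"
    by (auto simp: r_coset_def)
  also have "\<dots> \<longleftrightarrow> x - y \<in> tensor_rel R M N"
    by (metis add_diff_cancel diff_add_cancel)
  finally show ?thesis .
qed

lemma tensor_rel_map:
  assumes M: "right_module R M" and N: "left_module R N"
    and M': "right_module R M'" and N': "left_module R N'"
    and f: "\<And>x. x \<in> carrier M \<Longrightarrow> f x \<in> carrier M'"
      "\<And>x y. x \<in> carrier M \<Longrightarrow> y \<in> carrier M \<Longrightarrow> f (x \<oplus>\<^bsub>M\<^esub> y) = f x \<oplus>\<^bsub>M'\<^esub> f y"
      "\<And>a x. a \<in> carrier R \<Longrightarrow> x \<in> carrier M \<Longrightarrow> f (a \<odot>\<^bsub>M\<^esub> x) = a \<odot>\<^bsub>M'\<^esub> f x"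
    and g: "\<And>x. x \<in> carrier N \<Longrightarrow> g x \<in> carrier N'"
      "\<And>x y. x \<in> carrier N \<Longrightarrow> y \<in> carrier N \<Longrightarrow> g (x \<oplus>\<^bsub>N\<^esub> y) = g x \<oplus>\<^bsub>N'\<^esub> g y"
      "\<And>a x. a \<in> carrier R \<Longrightarrow> x \<in> carrier N \<Longrightarrow> g (a \<odot>\<^bsub>N\<^esub> x) = a \<odot>\<^bsub>N'\<^esub> g x"
    and x: "x \<in> tensor_rel R M N"
  shows "frag_extend (frag_of \<circ> map_prod f g) x \<in> tensor_rel R M' N'"
proof -
  let ?e = "frag_extend (frag_of \<circ> map_prod f g)"
  interpret K: subgroup "tensor_rel R M' N'" "tensor_free M' N'" by (rule tensor_rel_subgroup[OF M' N'])
  have rel: "?e r \<in> tensor_rel R M' N'" if "r \<in> tensor_relators R M N" for r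
  proof -
    have "?e r \<in> tensor_relators R M' N'"
      using that unfolding tensor_relators_def[of R M N]
    proof (elim UnE CollectE exE conjE)
      fix x y n assume "r = frag_of (x \<oplus>\<^bsub>M\<^esub> y, n) - frag_of (x, n) - frag_of (y, n)"
        and c: "x \<in> carrier M" "y \<in> carrier M" "n \<in> carrier N"
      then have "?e r = frag_of (f x \<oplus>\<^bsub>M'\<^esub> f y, g n) - frag_of (f x, g n) - frag_of (f y, g n)"
        by (simp add: frag_extend_diff f(2))
      then show ?thesis
        using f(1)[OF c(1)] f(1)[OF c(2)] g(1)[OF c(3)] unfolding tensor_relators_def by blast
    next
      fix x m n assume "r = frag_of (x, m \<oplus>\<^bsub>N\<^esub> n) - frag_of (x, m) - frag_of (x, n)"
        and c: "x \<in> carrier M" "m \<in> carrier N" "n \<in> carrier N"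
      then have "?e r = frag_of (f x, g m \<oplus>\<^bsub>N'\<^esub> g n) - frag_of (f x, g m) - frag_of (f x, g n)"
        by (simp add: frag_extend_diff g(2))
      then show ?thesis
        using f(1)[OF c(1)] g(1)[OF c(2)] g(1)[OF c(3)] unfolding tensor_relators_def by blast
    next
      fix a x n assume "r = frag_of (a \<odot>\<^bsub>M\<^esub> x, n) - frag_of (x, a \<odot>\<^bsub>N\<^esub> n)"
        and c: "a \<in> carrier R" "x \<in> carrier M" "n \<in> carrier N"
      then have "?e r = frag_of (a \<odot>\<^bsub>M'\<^esub> f x, g n) - frag_of (f x, a \<odot>\<^bsub>N'\<^esub> g n)"
        by (simp add: frag_extend_diff f(3) g(3))
      then show ?thesis
        using c(1) f(1)[OF c(2)] g(1)[OF c(3)] unfolding tensor_relators_def by blast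
    qed
    then show ?thesis
      unfolding tensor_rel_def by (rule generate.incl)
  qed
  show ?thesis
    using x unfolding tensor_rel_def[of R M N]
  proof (induction rule: generate.induct)
    case one
    then show ?case using K.one_closed by simp
  next
    case (incl h)
    then show ?case by (rule rel)
  next
    case (inv h)
    then have "Poly_Mapping.keys h \<subseteq> carrier M \<times> carrier N"
      by (intro keys_tensor_relators[OF M N])
    moreover have "Poly_Mapping.keys (?e h) \<subseteq> carrier M' \<times> carrier N'"
      using K.mem_carrier[OF rel[OF inv]] by simp
    ultimately show ?case
      using K.m_inv_closed[OF rel[OF inv]] by (simp add: frag_extend_minus comp_def)
  next
    case (eng h1 h2)
    then show ?case
      using K.m_closed by (simp add: frag_extend_add)
  qed
qed

lemma keys_map_prod:
  assumes "Poly_Mapping.keys x \<subseteq> A \<times> B" "f ` A \<subseteq> A'" "g ` B \<subseteq> B'"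
  shows "Poly_Mapping.keys (frag_extend (frag_of \<circ> map_prod f g) x) \<subseteq> A' \<times> B'"
proof
  fix u assume "u \<in> Poly_Mapping.keys (frag_extend (frag_of \<circ> map_prod f g) x)"
  then obtain a b where "(a, b) \<in> Poly_Mapping.keys x" "u = (f a, g b)"
    using keys_frag_extend[of "frag_of \<circ> map_prod f g" x] by (force simp: map_prod_def)
  then show "u \<in> A' \<times> B'"
    using assms by auto
qed

context
  fixes R :: "('a, 'c) ring_scheme" and P :: "('a, 'p, 'd) module_scheme"
    and M :: "('a, 'm, 'e) module_scheme" and N :: "('a, 'n, 'k) module_scheme" and f
  assumes P: "right_module R P" and M: "right_module R M" and N: "left_module R N"
    and f: "\<And>x. x \<in> carrier P \<Longrightarrow> f x \<in> carrier M"
      "\<And>x y. x \<in> carrier P \<Longrightarrow> y \<in> carrier P \<Longrightarrow> f (x \<oplus>\<^bsub>P\<^esub> y) = f x \<oplus>\<^bsub>M\<^esub> f y"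
      "\<And>a x. a \<in> carrier R \<Longrightarrow> x \<in> carrier P \<Longrightarrow> f (a \<odot>\<^bsub>P\<^esub> x) = a \<odot>\<^bsub>M\<^esub> f x"
begin

lemma tensor_map_coset:
  assumes x: "Poly_Mapping.keys x \<subseteq> carrier P \<times> carrier N"
  shows "tensor_map R M N f (tensor_rel R P N #>\<^bsub>tensor_free P N\<^esub> x) =
         tensor_rel R M N #>\<^bsub>tensor_free M N\<^esub> frag_extend (frag_of \<circ> map_prod f id) x"
proof -
  let ?e = "frag_extend (frag_of \<circ> map_prod f id) :: _ \<Rightarrow> ('m \<times> 'n \<Rightarrow>\<^sub>0 int)"
  interpret F: group "tensor_free P N" by simp
  interpret K: subgroup "tensor_rel R P N" "tensor_free P N" by (rule tensor_rel_subgroup[OF P N])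
  have kf: "Poly_Mapping.keys (?e y) \<subseteq> carrier M \<times> carrier N"
    if "Poly_Mapping.keys y \<subseteq> carrier P \<times> carrier N" for y
    using that by (rule keys_map_prod) (use f in auto)
  have "tensor_rel R M N #>\<^bsub>tensor_free M N\<^esub> ?e y = tensor_rel R M N #>\<^bsub>tensor_free M N\<^esub> ?e x"
    if "y \<in> tensor_rel R P N #>\<^bsub>tensor_free P N\<^esub> x" for y
  proof -
    obtain h where h: "h \<in> tensor_rel R P N" "y = h + x"
      using \<open>y \<in> _\<close> by (auto simp: r_coset_def)
    have "?e h \<in> tensor_rel R M N"
      using h(1) by (intro tensor_rel_map[OF P N M N]) (use f in auto)
    moreover have "?e y - ?e x = ?e h"
      by (simp add: h frag_extend_add)
    moreover have "Poly_Mapping.keys y \<subseteq> carrier P \<times> carrier N"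
      using K.mem_carrier[OF h(1)] x keys_add[of h x] by (auto simp: h)
    ultimately show ?thesis
      by (subst tensor_coset_eq_iff[OF M N]) (auto intro!: kf x)
  qed
  moreover have "x \<in> tensor_rel R P N #>\<^bsub>tensor_free P N\<^esub> x"
    using F.rcos_self[OF _ K.subgroup_axioms] x by simp
  ultimately show ?thesis
    unfolding tensor_map_def by blast
qed

lemma tensor_map_elem_tensor:
  assumes "x \<in> carrier P" "n \<in> carrier N"
  shows "tensor_map R M N f (elem_tensor R P N x n) = elem_tensor R M N (f x) n"
  using assms by (simp add: elem_tensor_def tensor_map_coset)

lemma tensor_map_hom: "tensor_map R M N f \<in> hom (tensor_product R P N) (tensor_product R M N)"
proof -
  let ?e = "frag_extend (frag_of \<circ> map_prod f id) :: _ \<Rightarrow> ('m \<times> 'n \<Rightarrow>\<^sub>0 int)"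
  have kf: "Poly_Mapping.keys (?e y) \<subseteq> carrier M \<times> carrier N"
    if "Poly_Mapping.keys y \<subseteq> carrier P \<times> carrier N" for y
    using that by (rule keys_map_prod) (use f in auto)
  have ks: "Poly_Mapping.keys (x + y) \<subseteq> carrier P \<times> carrier N"
    if "Poly_Mapping.keys x \<subseteq> carrier P \<times> carrier N" "Poly_Mapping.keys y \<subseteq> carrier P \<times> carrier N" for x y
    using that keys_add[of x y] by blast
  show ?thesis
  proof (rule homI)
    fix X assume "X \<in> carrier (tensor_product R P N)"
    then show "tensor_map R M N f X \<in> carrier (tensor_product R M N)"
      by (auto simp: tensor_product_def carrier_FactGroup tensor_map_coset intro!: imageI kf)
  next
    fix X Y assume "X \<in> carrier (tensor_product R P N)" "Y \<in> carrier (tensor_product R P N)"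
    then obtain x y where xy: "Poly_Mapping.keys x \<subseteq> carrier P \<times> carrier N"
        "Poly_Mapping.keys y \<subseteq> carrier P \<times> carrier N"
        "X = tensor_rel R P N #>\<^bsub>tensor_free P N\<^esub> x" "Y = tensor_rel R P N #>\<^bsub>tensor_free P N\<^esub> y"
      by (auto simp: tensor_product_def carrier_FactGroup)
    then show "tensor_map R M N f (X \<otimes>\<^bsub>tensor_product R P N\<^esub> Y) =
        tensor_map R M N f X \<otimes>\<^bsub>tensor_product R M N\<^esub> tensor_map R M N f Y"
      using normal.rcos_sum[OF tensor_rel_normal[OF P N], of x y]
        normal.rcos_sum[OF tensor_rel_normal[OF M N], of "?e x" "?e y"]
      by (simp add: tensor_product_def tensor_map_coset ks kf frag_extend_add)
  qed
qed

lemma inj_on_tensor_map_iff: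
  "inj_on (tensor_map R M N f) (carrier (tensor_product R P N)) \<longleftrightarrow>
   (\<forall>x. Poly_Mapping.keys x \<subseteq> carrier P \<times> carrier N \<longrightarrow>
      frag_extend (frag_of \<circ> map_prod f id) x \<in> tensor_rel R M N \<longrightarrow> x \<in> tensor_rel R P N)"
proof -
  let ?e = "frag_extend (frag_of \<circ> map_prod f id) :: _ \<Rightarrow> ('m \<times> 'n \<Rightarrow>\<^sub>0 int)"
  let ?S = "carrier P \<times> carrier N"
  have kf: "Poly_Mapping.keys (?e y) \<subseteq> carrier M \<times> carrier N"
    if "Poly_Mapping.keys y \<subseteq> ?S" for y
    using that by (rule keys_map_prod) (use f in auto)
  have kd: "Poly_Mapping.keys (x - y) \<subseteq> ?S"
    if "Poly_Mapping.keys x \<subseteq> ?S" "Poly_Mapping.keys y \<subseteq> ?S" for x y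
    using that keys_diff[of x y] by blast
  have "inj_on (tensor_map R M N f) (carrier (tensor_product R P N)) \<longleftrightarrow>
    (\<forall>x y. Poly_Mapping.keys x \<subseteq> ?S \<longrightarrow> Poly_Mapping.keys y \<subseteq> ?S \<longrightarrow>
       ?e (x - y) \<in> tensor_rel R M N \<longrightarrow> x - y \<in> tensor_rel R P N)"
    unfolding inj_on_def tensor_product_def carrier_FactGroup ball_simps(9)
    by (simp only: Ball_def carrier_free_Abelian_group_iff)
      (simp add: tensor_map_coset tensor_coset_eq_iff[OF M N] tensor_coset_eq_iff[OF P N] kf
        frag_extend_diff)
  also have "\<dots> \<longleftrightarrow> (\<forall>x. Poly_Mapping.keys x \<subseteq> ?S \<longrightarrow> ?e x \<in> tensor_rel R M N \<longrightarrow> x \<in> tensor_rel R P N)"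
    by (metis diff_zero empty_subsetI kd keys_zero)
  finally show ?thesis .
qed

end


section \<open>Purity does not depend on the type carrying the left modules\<close>

lemma right_module_submodule:
  assumes "right_module R M" "submodule P R M"
  shows "right_module R (M\<lparr>carrier := P\<rparr>)"
proof -
  interpret M: right_module R M by fact
  interpret P: submodule P R M by fact
  have PM: "x \<in> P \<Longrightarrow> x \<in> carrier M" for x
    using P.mem_carrier by simp
  have closed: "x \<in> P \<Longrightarrow> y \<in> P \<Longrightarrow> x \<oplus>\<^bsub>M\<^esub> y \<in> P" "\<zero>\<^bsub>M\<^esub> \<in> P"
    "x \<in> P \<Longrightarrow> \<ominus>\<^bsub>M\<^esub> x \<in> P" for x y
    using P.m_closed[of x y] P.one_closed P.m_inv_closed[of x] by (simp_all add: a_inv_def)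
  have "abelian_group (M\<lparr>carrier := P\<rparr>)"
  proof (rule abelian_groupI)
    fix x assume "x \<in> carrier (M\<lparr>carrier := P\<rparr>)"
    then have "\<ominus>\<^bsub>M\<^esub> x \<in> P" "\<ominus>\<^bsub>M\<^esub> x \<oplus>\<^bsub>M\<^esub> x = \<zero>\<^bsub>M\<^esub>"
      using closed(3) PM M.M.l_neg by auto
    then show "\<exists>y\<in>carrier (M\<lparr>carrier := P\<rparr>). y \<oplus>\<^bsub>M\<lparr>carrier := P\<rparr>\<^esub> x = \<zero>\<^bsub>M\<lparr>carrier := P\<rparr>\<^esub>"
      by auto
  next
    fix x y assume "x \<in> carrier (M\<lparr>carrier := P\<rparr>)" "y \<in> carrier (M\<lparr>carrier := P\<rparr>)"
    then show "x \<oplus>\<^bsub>M\<lparr>carrier := P\<rparr>\<^esub> y = y \<oplus>\<^bsub>M\<lparr>carrier := P\<rparr>\<^esub> x"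
      using PM M.M.a_comm by simp
  qed (use closed PM M.M.a_assoc in simp_all)
  then show ?thesis
    using PM P.smult_closed M.smult_l_distr M.smult_r_distr M.smult_assoc M.smult_one
    by (intro right_module.intro right_module_axioms.intro) (simp_all add: M.R.ring_axioms)
qed

lemma tensor_rel_finite_support:
  assumes M: "right_module R M" and N: "left_module R N" and x: "x \<in> tensor_rel R M N"
  shows "\<exists>F. finite F \<and> F \<subseteq> carrier N \<and>
    (\<forall>L. F \<subseteq> L \<and> left_module R (N\<lparr>carrier := L\<rparr>) \<longrightarrow> x \<in> tensor_rel R M (N\<lparr>carrier := L\<rparr>))"
  using x unfolding tensor_rel_def[of R M N]
proof (induction rule: generate.induct)
  have rel: "\<exists>F. finite F \<and> F \<subseteq> carrier N \<and>
      (\<forall>L. F \<subseteq> L \<longrightarrow> h \<in> tensor_relators R M (N\<lparr>carrier := L\<rparr>))"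
    if "h \<in> tensor_relators R M N" for h
    using that unfolding tensor_relators_def[of R M N]
  proof (elim UnE CollectE exE conjE)
    fix x y n assume h: "h = frag_of (x \<oplus>\<^bsub>M\<^esub> y, n) - frag_of (x, n) - frag_of (y, n)"
      "x \<in> carrier M" "y \<in> carrier M" "n \<in> carrier N"
    have "h \<in> tensor_relators R M (N\<lparr>carrier := L\<rparr>)" if "{n} \<subseteq> L" for L
      unfolding tensor_relators_def by (rule UnI1, rule UnI1) (use that h in auto)
    then show ?thesis
      using h(4) by (intro exI[of _ "{n}"]) simp
  next
    fix x m n assume h: "h = frag_of (x, m \<oplus>\<^bsub>N\<^esub> n) - frag_of (x, m) - frag_of (x, n)"
      "x \<in> carrier M" "m \<in> carrier N" "n \<in> carrier N"
    have "h \<in> tensor_relators R M (N\<lparr>carrier := L\<rparr>)" if "{m, n} \<subseteq> L" for L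
      unfolding tensor_relators_def by (rule UnI1, rule UnI2) (use that h in auto)
    then show ?thesis
      using h(3,4) by (intro exI[of _ "{m, n}"]) simp
  next
    fix a x n assume h: "h = frag_of (a \<odot>\<^bsub>M\<^esub> x, n) - frag_of (x, a \<odot>\<^bsub>N\<^esub> n)"
      "a \<in> carrier R" "x \<in> carrier M" "n \<in> carrier N"
    have "h \<in> tensor_relators R M (N\<lparr>carrier := L\<rparr>)" if "{n} \<subseteq> L" for L
      unfolding tensor_relators_def by (rule UnI2) (use that h in auto)
    then show ?thesis
      using h(4) by (intro exI[of _ "{n}"]) simp
  qed
  {
    case one
    have "0 \<in> tensor_rel R M (N\<lparr>carrier := L\<rparr>)" if "left_module R (N\<lparr>carrier := L\<rparr>)" for L
      using subgroup.one_closed[OF tensor_rel_subgroup[OF M that]] by simp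
    then show ?case
      by (intro exI[of _ "{}"]) simp
  next
    case (incl h)
    obtain F where F: "finite F" "F \<subseteq> carrier N"
      "\<And>L. F \<subseteq> L \<Longrightarrow> h \<in> tensor_relators R M (N\<lparr>carrier := L\<rparr>)"
      using rel[OF incl] by blast
    have "h \<in> tensor_rel R M (N\<lparr>carrier := L\<rparr>)" if "F \<subseteq> L" for L
      unfolding tensor_rel_def by (rule generate.incl[OF F(3)[OF that]])
    then show ?case
      using F(1,2) by blast
  next
    case (inv h)
    obtain F where F: "finite F" "F \<subseteq> carrier N"
      "\<And>L. F \<subseteq> L \<Longrightarrow> h \<in> tensor_relators R M (N\<lparr>carrier := L\<rparr>)"
      using rel[OF inv] by blast
    have "Poly_Mapping.keys h \<subseteq> carrier M \<times> carrier N"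
      by (rule keys_tensor_relators[OF M N inv])
    then have i: "inv\<^bsub>tensor_free M N\<^esub> h = - h" by simp
    have "- h \<in> tensor_rel R M (N\<lparr>carrier := L\<rparr>)" if "F \<subseteq> L" "left_module R (N\<lparr>carrier := L\<rparr>)" for L
    proof -
      have "Poly_Mapping.keys h \<subseteq> carrier M \<times> L"
        using keys_tensor_relators[OF M that(2) F(3)[OF that(1)]] by simp
      then have i': "inv\<^bsub>tensor_free M (N\<lparr>carrier := L\<rparr>)\<^esub> h = - h" by simp
      have "inv\<^bsub>tensor_free M (N\<lparr>carrier := L\<rparr>)\<^esub> h \<in> tensor_rel R M (N\<lparr>carrier := L\<rparr>)"
        unfolding tensor_rel_def by (rule generate.inv[OF F(3)[OF that(1)]])
      then show ?thesis
        unfolding i' .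
    qed
    then show ?case
      unfolding i using F(1,2) by blast
  next
    case (eng h1 h2)
    obtain F1 where F1: "finite F1" "F1 \<subseteq> carrier N"
      "\<And>L. F1 \<subseteq> L \<Longrightarrow> left_module R (N\<lparr>carrier := L\<rparr>) \<Longrightarrow> h1 \<in> tensor_rel R M (N\<lparr>carrier := L\<rparr>)"
      using eng.IH(1) by auto
    obtain F2 where F2: "finite F2" "F2 \<subseteq> carrier N"
      "\<And>L. F2 \<subseteq> L \<Longrightarrow> left_module R (N\<lparr>carrier := L\<rparr>) \<Longrightarrow> h2 \<in> tensor_rel R M (N\<lparr>carrier := L\<rparr>)"
      using eng.IH(2) by auto
    have "h1 + h2 \<in> tensor_rel R M (N\<lparr>carrier := L\<rparr>)"
      if "F1 \<union> F2 \<subseteq> L" "left_module R (N\<lparr>carrier := L\<rparr>)" for L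
      using subgroup.m_closed[OF tensor_rel_subgroup[OF M that(2)] F1(3)[OF _ that(2)] F2(3)[OF _ that(2)]] that(1)
      by simp
    then show ?case
      using F1(1,2) F2(1,2) by (intro exI[of _ "F1 \<union> F2"]) simp
  }
qed

primrec lincomb :: "('a, 'n, 'e) module_scheme \<Rightarrow> 'n list \<Rightarrow> (nat \<Rightarrow> 'a) \<Rightarrow> 'n" where
  "lincomb N [] c = \<zero>\<^bsub>N\<^esub>"
| "lincomb N (n # ns) c = c 0 \<odot>\<^bsub>N\<^esub> n \<oplus>\<^bsub>N\<^esub> lincomb N ns (c \<circ> Suc)"

context left_module
begin

lemma zero_smult: "x \<in> carrier M \<Longrightarrow> \<zero>\<^bsub>R\<^esub> \<odot>\<^bsub>M\<^esub> x = \<zero>\<^bsub>M\<^esub>"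
  using smult_l_distr[of "\<zero>\<^bsub>R\<^esub>" "\<zero>\<^bsub>R\<^esub>" x] M.add.l_cancel_one[of "\<zero>\<^bsub>R\<^esub> \<odot>\<^bsub>M\<^esub> x" "\<zero>\<^bsub>R\<^esub> \<odot>\<^bsub>M\<^esub> x"]
  by (metis R.l_zero R.zero_closed smult_closed)

lemma smult_zero: "a \<in> carrier R \<Longrightarrow> a \<odot>\<^bsub>M\<^esub> \<zero>\<^bsub>M\<^esub> = \<zero>\<^bsub>M\<^esub>"
  using smult_r_distr[of a "\<zero>\<^bsub>M\<^esub>" "\<zero>\<^bsub>M\<^esub>"] M.add.l_cancel_one[of "a \<odot>\<^bsub>M\<^esub> \<zero>\<^bsub>M\<^esub>" "a \<odot>\<^bsub>M\<^esub> \<zero>\<^bsub>M\<^esub>"]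
  by (metis M.l_zero M.zero_closed smult_closed)

lemma lincomb_closed: "set ns \<subseteq> carrier M \<Longrightarrow> range c \<subseteq> carrier R \<Longrightarrow> lincomb M ns c \<in> carrier M"
proof (induction ns arbitrary: c)
  case (Cons n ns)
  then have "range (c \<circ> Suc) \<subseteq> carrier R" "c 0 \<in> carrier R" by auto
  then have "lincomb M ns (c \<circ> Suc) \<in> carrier M" "c 0 \<odot>\<^bsub>M\<^esub> n \<in> carrier M"
    using Cons by auto
  then show ?case by simp
qed auto

lemma lincomb_add:
  "set ns \<subseteq> carrier M \<Longrightarrow> range c \<subseteq> carrier R \<Longrightarrow> range d \<subseteq> carrier R \<Longrightarrow>
   lincomb M ns (\<lambda>i. c i \<oplus>\<^bsub>R\<^esub> d i) = lincomb M ns c \<oplus>\<^bsub>M\<^esub> lincomb M ns d"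
proof (induction ns arbitrary: c d)
  case (Cons n ns)
  then have r: "range (c \<circ> Suc) \<subseteq> carrier R" "range (d \<circ> Suc) \<subseteq> carrier R" by auto
  have "c 0 \<in> carrier R" "d 0 \<in> carrier R" "n \<in> carrier M" using Cons by auto
  moreover have "lincomb M ns ((\<lambda>i. c i \<oplus>\<^bsub>R\<^esub> d i) \<circ> Suc) =
      lincomb M ns (c \<circ> Suc) \<oplus>\<^bsub>M\<^esub> lincomb M ns (d \<circ> Suc)"
    using Cons.IH[OF _ r] Cons.prems(1) by (simp add: comp_def)
  moreover have "lincomb M ns (c \<circ> Suc) \<in> carrier M" "lincomb M ns (d \<circ> Suc) \<in> carrier M"
    using Cons.prems(1) r lincomb_closed by auto
  ultimately show ?case
    by (simp add: smult_l_distr M.a_ac)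
qed auto

lemma lincomb_smult:
  "set ns \<subseteq> carrier M \<Longrightarrow> range c \<subseteq> carrier R \<Longrightarrow> a \<in> carrier R \<Longrightarrow>
   lincomb M ns (\<lambda>i. a \<otimes>\<^bsub>R\<^esub> c i) = a \<odot>\<^bsub>M\<^esub> lincomb M ns c"
proof (induction ns arbitrary: c)
  case (Cons n ns)
  then have r: "range (c \<circ> Suc) \<subseteq> carrier R" by auto
  have "c 0 \<in> carrier R" "n \<in> carrier M" using Cons by auto
  moreover have "lincomb M ns ((\<lambda>i. a \<otimes>\<^bsub>R\<^esub> c i) \<circ> Suc) = a \<odot>\<^bsub>M\<^esub> lincomb M ns (c \<circ> Suc)"
    using Cons.IH[OF _ r] Cons.prems by (simp add: comp_def)
  moreover have "lincomb M ns (c \<circ> Suc) \<in> carrier M"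
    using Cons.prems(1) r lincomb_closed by auto
  ultimately show ?case
    using Cons.prems(3) by (simp add: smult_r_distr smult_assoc)
qed (simp add: smult_zero)

lemma lincomb_zero: "set ns \<subseteq> carrier M \<Longrightarrow> lincomb M ns (\<lambda>_. \<zero>\<^bsub>R\<^esub>) = \<zero>\<^bsub>M\<^esub>"
  by (induction ns) (auto simp: zero_smult comp_def)

lemma lincomb_generator:
  "set ns \<subseteq> carrier M \<Longrightarrow> n \<in> set ns \<Longrightarrow> \<exists>c. range c \<subseteq> carrier R \<and> lincomb M ns c = n"
proof (induction ns)
  case (Cons m ns)
  show ?case
  proof (cases "n = m")
    case True
    let ?c = "\<lambda>i::nat. if i = 0 then \<one>\<^bsub>R\<^esub> else \<zero>\<^bsub>R\<^esub>"
    have "?c \<circ> Suc = (\<lambda>_. \<zero>\<^bsub>R\<^esub>)" by auto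
    then have "lincomb M (m # ns) ?c = m"
      using Cons.prems by (simp add: lincomb_zero)
    then show ?thesis
      using True by (intro exI[of _ ?c]) auto
  next
    case False
    then obtain c where c: "range c \<subseteq> carrier R" "lincomb M ns c = n"
      using Cons by auto
    let ?c = "\<lambda>i::nat. case i of 0 \<Rightarrow> \<zero>\<^bsub>R\<^esub> | Suc j \<Rightarrow> c j"
    have "?c \<circ> Suc = c" by auto
    then have "lincomb M (m # ns) ?c = n"
      using Cons.prems c by (auto simp: zero_smult)
    moreover have "range ?c \<subseteq> carrier R"
      using c(1) by (fastforce split: nat.split)
    ultimately show ?thesis by blast
  qed
qed auto

lemma left_module_subset:
  assumes "L \<subseteq> carrier M" "\<zero>\<^bsub>M\<^esub> \<in> L" "\<And>x y. x \<in> L \<Longrightarrow> y \<in> L \<Longrightarrow> x \<oplus>\<^bsub>M\<^esub> y \<in> L"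
    "\<And>a x. a \<in> carrier R \<Longrightarrow> x \<in> L \<Longrightarrow> a \<odot>\<^bsub>M\<^esub> x \<in> L"
  shows "left_module R (M\<lparr>carrier := L\<rparr>)"
proof -
  have "abelian_group (M\<lparr>carrier := L\<rparr>)"
  proof (rule abelian_groupI)
    fix x assume "x \<in> carrier (M\<lparr>carrier := L\<rparr>)"
    then have x: "x \<in> L" "x \<in> carrier M" using assms(1) by auto
    have "(\<ominus>\<^bsub>R\<^esub> \<one>\<^bsub>R\<^esub>) \<odot>\<^bsub>M\<^esub> x \<oplus>\<^bsub>M\<^esub> x = (\<ominus>\<^bsub>R\<^esub> \<one>\<^bsub>R\<^esub> \<oplus>\<^bsub>R\<^esub> \<one>\<^bsub>R\<^esub>) \<odot>\<^bsub>M\<^esub> x"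
      using x by (subst smult_l_distr) auto
    then have "(\<ominus>\<^bsub>R\<^esub> \<one>\<^bsub>R\<^esub>) \<odot>\<^bsub>M\<^esub> x \<oplus>\<^bsub>M\<^esub> x = \<zero>\<^bsub>M\<^esub>"
      using x by (simp add: R.l_neg zero_smult)
    then show "\<exists>y\<in>carrier (M\<lparr>carrier := L\<rparr>). y \<oplus>\<^bsub>M\<lparr>carrier := L\<rparr>\<^esub> x = \<zero>\<^bsub>M\<lparr>carrier := L\<rparr>\<^esub>"
      using x assms(4) by auto
  next
    fix x y assume "x \<in> carrier (M\<lparr>carrier := L\<rparr>)" "y \<in> carrier (M\<lparr>carrier := L\<rparr>)"
    then show "x \<oplus>\<^bsub>M\<lparr>carrier := L\<rparr>\<^esub> y = y \<oplus>\<^bsub>M\<lparr>carrier := L\<rparr>\<^esub> x"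
      using assms(1) M.a_comm[of x y] by auto
  qed (use assms(1-3) in \<open>auto simp: M.a_assoc subset_iff\<close>)
  then show ?thesis
    using assms(1,4)
    by (intro left_module.intro left_module_axioms.intro)
      (auto simp: R.ring_axioms smult_l_distr smult_r_distr smult_assoc subset_iff)
qed

lemma left_module_lincomb:
  assumes "set ns \<subseteq> carrier M"
  shows "left_module R (M\<lparr>carrier := lincomb M ns ` {c. range c \<subseteq> carrier R}\<rparr>)"
proof (rule left_module_subset)
  show "\<zero>\<^bsub>M\<^esub> \<in> lincomb M ns ` {c. range c \<subseteq> carrier R}"
    using lincomb_zero[OF assms] by (force intro!: image_eqI[of _ _ "\<lambda>_. \<zero>\<^bsub>R\<^esub>"])
  fix x y assume "x \<in> lincomb M ns ` {c. range c \<subseteq> carrier R}" "y \<in> lincomb M ns ` {c. range c \<subseteq> carrier R}"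
  then obtain c d where "range c \<subseteq> carrier R" "x = lincomb M ns c" "range d \<subseteq> carrier R" "y = lincomb M ns d"
    by blast
  then show "x \<oplus>\<^bsub>M\<^esub> y \<in> lincomb M ns ` {c. range c \<subseteq> carrier R}"
    using lincomb_add[OF assms, of c d]
    by (intro image_eqI[of _ _ "\<lambda>i. c i \<oplus>\<^bsub>R\<^esub> d i"]) auto
next
  fix a x assume a: "a \<in> carrier R" and "x \<in> lincomb M ns ` {c. range c \<subseteq> carrier R}"
  then obtain c where "range c \<subseteq> carrier R" "x = lincomb M ns c"
    by blast
  then show "a \<odot>\<^bsub>M\<^esub> x \<in> lincomb M ns ` {c. range c \<subseteq> carrier R}"
    using lincomb_smult[OF assms _ a, of c] a
    by (intro image_eqI[of _ _ "\<lambda>i. a \<otimes>\<^bsub>R\<^esub> c i"]) auto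
qed (use lincomb_closed[OF assms] in auto)

text \<open>Transport of structure along an injection.\<close>

lemma left_module_transport:
  fixes g :: "_ \<Rightarrow> 'u"
  assumes g: "inj_on g (carrier M)"
  obtains U :: "('a, 'u) module" and h where
    "left_module R U" "carrier U = g ` carrier M"
    "\<And>x. x \<in> carrier M \<Longrightarrow> h (g x) = x"
    "\<And>x y. x \<in> carrier M \<Longrightarrow> y \<in> carrier M \<Longrightarrow> g (x \<oplus>\<^bsub>M\<^esub> y) = g x \<oplus>\<^bsub>U\<^esub> g y"
    "\<And>a x. a \<in> carrier R \<Longrightarrow> x \<in> carrier M \<Longrightarrow> g (a \<odot>\<^bsub>M\<^esub> x) = a \<odot>\<^bsub>U\<^esub> g x"
proof -
  define h where "h = inv_into (carrier M) g"
  have h: "h (g x) = x" if "x \<in> carrier M" for x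
    using that g by (simp add: h_def)
  define U :: "('a, 'u) module" where
    "U = \<lparr>carrier = g ` carrier M, monoid.mult = undefined, one = undefined, ring.zero = g \<zero>\<^bsub>M\<^esub>,
      add = (\<lambda>u v. g (h u \<oplus>\<^bsub>M\<^esub> h v)), smult = (\<lambda>a u. g (a \<odot>\<^bsub>M\<^esub> h u))\<rparr>"
  have [simp]: "carrier U = g ` carrier M" "\<zero>\<^bsub>U\<^esub> = g \<zero>\<^bsub>M\<^esub>"
    "\<And>u v. u \<oplus>\<^bsub>U\<^esub> v = g (h u \<oplus>\<^bsub>M\<^esub> h v)" "\<And>a u. a \<odot>\<^bsub>U\<^esub> u = g (a \<odot>\<^bsub>M\<^esub> h u)"
    by (simp_all add: U_def)
  have "abelian_group U"
  proof (rule abelian_groupI)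
    fix u assume "u \<in> carrier U"
    then obtain x where x: "x \<in> carrier M" "u = g x" by auto
    then show "\<exists>y\<in>carrier U. y \<oplus>\<^bsub>U\<^esub> u = \<zero>\<^bsub>U\<^esub>"
      by (intro bexI[of _ "g (\<ominus>\<^bsub>M\<^esub> x)"]) (auto simp: h M.l_neg)
  next
    fix u v assume "u \<in> carrier U" "v \<in> carrier U"
    then obtain x y where "x \<in> carrier M" "u = g x" "y \<in> carrier M" "v = g y" by auto
    then show "u \<oplus>\<^bsub>U\<^esub> v = v \<oplus>\<^bsub>U\<^esub> u"
      using M.a_comm[of x y] by (simp add: h)
  qed (auto simp: h M.a_assoc)
  then have "left_module R U"
    by (intro left_module.intro left_module_axioms.intro)
      (auto simp: R.ring_axioms h smult_l_distr smult_r_distr smult_assoc)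
  then show thesis
    by (rule that[of U h]) (auto simp: h)
qed

end

theorem pure_submodule_imp_wrt:
  fixes R :: "('a, 'c) ring_scheme" and M :: "('a, 'm, 'd) module_scheme"
  assumes M: "right_module R M" and pure: "pure_submodule R P M"
  shows "pure_submodule_wrt TYPE('n) R P M"
proof -
  let ?P = "M\<lparr>carrier := P\<rparr>"
  have sub: "submodule P R M"
    using pure by (simp add: pure_submodule_def pure_submodule_wrt_def)
  have P: "right_module R ?P"
    by (rule right_module_submodule[OF M sub])
  have incl: "x \<in> carrier ?P \<Longrightarrow> x \<in> carrier M" for x
    using subgroup.mem_carrier[OF submodule.axioms(1)[OF sub]] by auto
  have iff: "inj_on (tensor_map R M N (\<lambda>x. x)) (carrier (tensor_product R ?P N)) \<longleftrightarrow>
      (\<forall>x. Poly_Mapping.keys x \<subseteq> P \<times> carrier N \<longrightarrow> x \<in> tensor_rel R M N \<longrightarrow> x \<in> tensor_rel R ?P N)"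
    if "left_module R N" for N :: "('a, 'k) module"
    by (subst inj_on_tensor_map_iff[OF P M that])
      (use incl in \<open>auto simp: comp_def map_prod_def id_def simp flip: frag_expansion\<close>)
  have "x \<in> tensor_rel R ?P N"
    if N: "left_module R N" and x: "Poly_Mapping.keys x \<subseteq> P \<times> carrier N" "x \<in> tensor_rel R M N"
    for N :: "('a, 'n) module" and x
  proof -
    interpret N: left_module R N by fact
    obtain F where F: "finite F" "F \<subseteq> carrier N"
      "\<And>L. F \<subseteq> L \<Longrightarrow> left_module R (N\<lparr>carrier := L\<rparr>) \<Longrightarrow> x \<in> tensor_rel R M (N\<lparr>carrier := L\<rparr>)"
      using tensor_rel_finite_support[OF M N x(2)] by blast
    obtain ns where ns: "set ns = F \<union> snd ` Poly_Mapping.keys x"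
      using F(1) finite_list[of "F \<union> snd ` Poly_Mapping.keys x"] by auto
    have nsN: "set ns \<subseteq> carrier N"
      using F(2) x(1) by (auto simp: ns)
    define L where "L = lincomb N ns ` {c. range c \<subseteq> carrier R}"
    let ?L = "N\<lparr>carrier := L\<rparr>"
    have L: "left_module R ?L"
      unfolding L_def by (rule N.left_module_lincomb[OF nsN])
    have LN: "L \<subseteq> carrier N"
      using N.lincomb_closed[OF nsN] by (auto simp: L_def)
    have nsL: "set ns \<subseteq> L"
      using N.lincomb_generator[OF nsN] by (fastforce simp: L_def)
    define g where "g n = {c. range c \<subseteq> carrier R \<and> lincomb N ns c = n}" for n
    have "inj_on g (carrier ?L)"
      by (rule inj_onI) (auto simp: g_def L_def)
    then obtain U :: "('a, (nat \<Rightarrow> 'a) set) module" and h where U: "left_module R U"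
      "carrier U = g ` carrier ?L"
      "\<And>n. n \<in> carrier ?L \<Longrightarrow> h (g n) = n"
      "\<And>m n. m \<in> carrier ?L \<Longrightarrow> n \<in> carrier ?L \<Longrightarrow> g (m \<oplus>\<^bsub>?L\<^esub> n) = g m \<oplus>\<^bsub>U\<^esub> g n"
      "\<And>a n. a \<in> carrier R \<Longrightarrow> n \<in> carrier ?L \<Longrightarrow> g (a \<odot>\<^bsub>?L\<^esub> n) = a \<odot>\<^bsub>U\<^esub> g n"
      by (rule left_module.left_module_transport[OF L]) (rule that)
    have LL: "m \<oplus>\<^bsub>N\<^esub> n \<in> L" "a \<odot>\<^bsub>N\<^esub> m \<in> L" if "m \<in> L" "n \<in> L" "a \<in> carrier R" for m n a
    proof -
      interpret L: left_module R ?L by (rule L)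
      show "m \<oplus>\<^bsub>N\<^esub> n \<in> L" "a \<odot>\<^bsub>N\<^esub> m \<in> L"
        using L.M.a_closed[of m n] L.smult_closed[of a m] that by auto
    qed
    let ?y = "frag_extend (frag_of \<circ> map_prod (\<lambda>x. x) g) x"
    have kx: "Poly_Mapping.keys x \<subseteq> P \<times> L"
      using x(1) nsL by (fastforce simp: ns)
    have "x \<in> tensor_rel R M ?L"
      using F(3) L nsL by (simp add: ns)
    then have "?y \<in> tensor_rel R M U"
      by (intro tensor_rel_map[OF M L M U(1)]) (use U in auto)
    moreover have "Poly_Mapping.keys ?y \<subseteq> P \<times> carrier U"
      using kx by (rule keys_map_prod) (auto simp: U(2))
    moreover have "inj_on (tensor_map R M U (\<lambda>x. x)) (carrier (tensor_product R ?P U))"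
      using pure U(1) by (simp add: pure_submodule_def pure_submodule_wrt_def)
    ultimately have y: "?y \<in> tensor_rel R ?P U"
      by (simp add: iff[OF U(1)])
    have "frag_extend (frag_of \<circ> map_prod (\<lambda>x. x) h) ?y \<in> tensor_rel R ?P N"
    proof (rule tensor_rel_map[OF P U(1) P N _ _ _ _ _ _ y])
      fix u v assume "u \<in> carrier U" "v \<in> carrier U"
      then obtain m n where mn: "u = g m" "v = g n" "m \<in> L" "n \<in> L" by (auto simp: U(2))
      then show "h u \<in> carrier N"
        using U(3) LN by auto
      show "h (u \<oplus>\<^bsub>U\<^esub> v) = h u \<oplus>\<^bsub>N\<^esub> h v"
        using U(4)[of m n] mn LL(1)[of m n "\<zero>\<^bsub>R\<^esub>"] by (simp add: U(3) flip: U(4))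
    next
      fix a u assume "a \<in> carrier R" "u \<in> carrier U"
      then obtain m where m: "u = g m" "m \<in> L" "a \<in> carrier R" by (auto simp: U(2))
      then show "h (a \<odot>\<^bsub>U\<^esub> u) = a \<odot>\<^bsub>N\<^esub> h u"
        using U(5)[of a m] LL(2)[of m m a] by (simp add: U(3) flip: U(5))
    qed (use U(2,3) LN in auto)
    moreover have "frag_extend (frag_of \<circ> map_prod (\<lambda>x. x) h) ?y = x"
    proof -
      have "frag_extend (frag_of \<circ> map_prod (\<lambda>x. x) h) ?y =
          frag_extend ((frag_of \<circ> map_prod (\<lambda>x. x) h) \<circ> map_prod (\<lambda>x. x) g) x"
        by (rule frag_extend_compose)
      also have "\<dots> = frag_extend frag_of x"
        by (rule frag_extend_eq) (use kx U(3) in auto)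
      finally show ?thesis
        by (simp flip: frag_expansion)
    qed
    ultimately show ?thesis by simp
  qed
  then show ?thesis
    unfolding pure_submodule_wrt_def by (simp add: sub iff)
qed

end

theory Submission
  imports Defs
begin

text \<open>
  Let \<open>P\<close> be a pure right ideal of \<open>R\<close> and \<open>a \<in> P\<close>. Tensoring \<open>P \<subseteq> R\<close> with the left module \<open>R/Ra\<close>
  gives an injection \<open>P/Pa \<rightarrow> R/Ra\<close>, which kills \<open>a\<close>; hence \<open>a = pa\<close> for some \<open>p \<in> P\<close>. If \<open>R\<close> is local
  and \<open>P \<noteq> R\<close>, then \<open>P\<close> lies in the maximal right ideal, so \<open>1 - p\<close> is a unit and \<open>(1 - p)a = 0\<close>
  forces \<open>a = 0\<close>. Thus the only pure right ideals are \<open>0\<close> and \<open>R\<close>, both direct summands.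
\<close>

context ring
begin

section \<open>Right ideals and the existence of maximal ones\<close>

text \<open>Closure under negation comes from right multiplication by
  \<open>\<ominus> \<one>\<close>.\<close>

lemma submodule_right_regularI:
  assumes "K \<subseteq> carrier R" "\<zero> \<in> K" "\<And>x y. x \<in> K \<Longrightarrow> y \<in> K \<Longrightarrow> x \<oplus> y \<in> K"
    "\<And>x r. x \<in> K \<Longrightarrow> r \<in> carrier R \<Longrightarrow> x \<otimes> r \<in> K"
  shows "submodule K R (right_regular R)"
proof -
  interpret M: right_module R "right_regular R"
    by (rule right_module_right_regular)
  have inv: "\<ominus>\<^bsub>right_regular R\<^esub> x \<in> K" if "x \<in> K" for x
  proof -
    have x: "x \<in> carrier R" using assms(1) that by auto
    have "x \<oplus> x \<otimes> (\<ominus> \<one>) = \<zero>"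
      using x by (simp add: r_minus r_neg)
    then have "\<ominus>\<^bsub>right_regular R\<^esub> x = x \<otimes> (\<ominus> \<one>)"
      using x M.M.minus_equality[of "x \<otimes> (\<ominus> \<one>)" x] by (simp add: a_comm)
    then show ?thesis
      using assms(4)[OF that] by simp
  qed
  show ?thesis
    using assms inv[unfolded a_inv_def]
    by (intro submodule.intro subgroup.intro submodule_axioms.intro) auto
qed

lemma submodule_right_regularD:
  assumes "submodule K R (right_regular R)"
  shows "K \<subseteq> carrier R" "\<zero> \<in> K" "\<And>x y. x \<in> K \<Longrightarrow> y \<in> K \<Longrightarrow> x \<oplus> y \<in> K"
    "\<And>x r. x \<in> K \<Longrightarrow> r \<in> carrier R \<Longrightarrow> x \<otimes> r \<in> K"
proof -
  interpret K: submodule K R "right_regular R" by fact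
  show "K \<subseteq> carrier R" "\<zero> \<in> K" "\<And>x y. x \<in> K \<Longrightarrow> y \<in> K \<Longrightarrow> x \<oplus> y \<in> K"
    "\<And>x r. x \<in> K \<Longrightarrow> r \<in> carrier R \<Longrightarrow> x \<otimes> r \<in> K"
    using K.subset K.one_closed K.m_closed K.smult_closed by auto
qed

lemma submodule_right_regular_eq_carrier:
  assumes "submodule K R (right_regular R)" "\<one> \<in> K"
  shows "K = carrier R"
  using submodule_right_regularD[OF assms(1)] assms(2) l_one by (metis subsetI subset_antisym)

lemma additive_subgroupI_minus:
  assumes "H \<subseteq> carrier R" "\<zero> \<in> H" "\<And>x y. x \<in> H \<Longrightarrow> y \<in> H \<Longrightarrow> x \<ominus> y \<in> H"
  shows "additive_subgroup H R"
proof (rule additive_subgroupI, rule add.subgroupI)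
  show inv: "\<ominus> x \<in> H" if "x \<in> H" for x
    using assms(3)[OF assms(2) that] that assms(1) by (auto simp: minus_eq)
  show "x \<oplus> y \<in> H" if "x \<in> H" "y \<in> H" for x y
    using assms(3)[OF that(1) inv[OF that(2)]] that assms(1) by (auto simp: minus_eq)
qed (use assms(1,2) in auto)

text \<open>Zorn's lemma on the proper right ideals above \<open>K\<close>.\<close>

lemma exists_maximal_right_ideal:
  assumes K: "submodule K R (right_regular R)" "K \<noteq> carrier R"
  shows "\<exists>J. maximal_right_ideal J R \<and> K \<subseteq> J"
proof -
  \<comment> \<open>Properness is expressed as \<open>\<one> \<notin> L\<close>, equivalent to it
    for right ideals, because this form passes directly to unions of chains.\<close>
  define A where "A = {L. submodule L R (right_regular R) \<and> \<one> \<notin> L \<and> K \<subseteq> L}"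
  have "\<exists>M\<in>A. \<forall>X\<in>A. M \<subseteq> X \<longrightarrow> X = M"
  proof (rule subset_Zorn_nonempty)
    show "A \<noteq> {}"
      using K submodule_right_regular_eq_carrier by (auto simp: A_def)
    fix C assume C: "C \<noteq> {}" "subset.chain A C"
    then have sub: "\<And>L. L \<in> C \<Longrightarrow> submodule L R (right_regular R)"
      and ne: "\<And>L. L \<in> C \<Longrightarrow> \<one> \<notin> L \<and> K \<subseteq> L"
      by (auto simp: A_def subset.chain_def)
    note L = submodule_right_regularD[OF sub]
    have "submodule (\<Union>C) R (right_regular R)"
    proof (rule submodule_right_regularI)
      fix x y assume "x \<in> \<Union>C" "y \<in> \<Union>C"
      then obtain L L' where *: "L \<in> C" "x \<in> L" "L' \<in> C" "y \<in> L'" by auto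
      then have "L \<subseteq> L' \<or> L' \<subseteq> L"
        using C(2) by (auto simp: subset.chain_def)
      then show "x \<oplus> y \<in> \<Union>C"
        using * L(3)[OF *(1)] L(3)[OF *(3)] by (meson UnionI subsetD)
    next
      show "\<Union>C \<subseteq> carrier R"
        using L(1) by blast
      show "\<zero> \<in> \<Union>C"
        using L(2) C(1) by auto
      show "x \<otimes> r \<in> \<Union>C" if "x \<in> \<Union>C" "r \<in> carrier R" for x r
        using L(4) that by (meson UnionE UnionI)
    qed
    then show "\<Union>C \<in> A"
      using ne C(1) by (auto simp: A_def)
  qed
  then obtain J where J: "J \<in> A" "\<And>X. X \<in> A \<Longrightarrow> J \<subseteq> X \<Longrightarrow> X = J"
    by blast
  have "maximal_right_ideal J R"
    unfolding maximal_right_ideal_def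
    using J submodule_right_regular_eq_carrier by (auto simp: A_def)
  then show ?thesis
    using J(1) by (auto simp: A_def)
qed

section \<open>The left module \<open>R/I\<close> and what purity says when tensoring with
  it\<close>

lemma a_rcosets_iff: "X \<in> a_rcosets I \<longleftrightarrow> (\<exists>x\<in>carrier R. X = I +> x)"
  by (auto simp: A_RCOSETS_def RCOSETS_def a_r_coset_def)

text \<open>The library's \<open>Quot\<close> is only a ring for two-sided ideals; here \<open>I\<close> will be a left ideal.\<close>

definition left_quotient :: "'a set \<Rightarrow> ('a, 'a set) module" where
  "left_quotient I = \<lparr>carrier = a_rcosets I, monoid.mult = undefined, one = undefined,
     ring.zero = I, add = set_add R, smult = (\<lambda>r X. \<Union>x\<in>X. I +> (r \<otimes> x))\<rparr>"

lemma left_quotient_simps [simp]: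
  "carrier (left_quotient I) = a_rcosets I"
  "\<zero>\<^bsub>left_quotient I\<^esub> = I"
  "X \<oplus>\<^bsub>left_quotient I\<^esub> Y = X <+>\<^bsub>R\<^esub> Y"
  by (simp_all add: left_quotient_def)

context
  fixes I
  assumes I: "additive_subgroup I R" "\<And>r i. r \<in> carrier R \<Longrightarrow> i \<in> I \<Longrightarrow> r \<otimes> i \<in> I"
begin

interpretation I: abelian_subgroup I R
  using I(1) abelian_group_axioms by (rule abelian_subgroupI3)

text \<open>Two representatives of a coset differ by some \<open>i\<close> in \<open>I\<close>, so
  their multiples by \<open>r\<close> differ by \<open>r \<otimes> i\<close>, which stays in the
  left ideal \<open>I\<close>. All members of the union defining the scalar action therefore
  coincide.\<close>

lemma smult_left_quotient:
  assumes "r \<in> carrier R" "x \<in> carrier R"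
  shows "r \<odot>\<^bsub>left_quotient I\<^esub> (I +> x) = I +> (r \<otimes> x)"
proof -
  have "I +> (r \<otimes> y) = I +> (r \<otimes> x)" if y: "y \<in> I +> x" for y
  proof -
    obtain i where i: "i \<in> I" "y = i \<oplus> x"
      using y by (auto simp: a_r_coset_def r_coset_def)
    then have iR: "i \<in> carrier R"
      by (auto intro: I.a_Hcarr)
    have "r \<otimes> y = r \<otimes> i \<oplus> r \<otimes> x"
      using assms iR i by (simp add: r_distr)
    then have "r \<otimes> y \<in> I +> (r \<otimes> x)"
      using I(2)[OF assms(1) i(1)] by (auto simp: a_r_coset_def r_coset_def)
    then show ?thesis
      using assms I.a_repr_independence'[of "r \<otimes> y" "r \<otimes> x"] by simp
  qed
  then have "(\<Union>y\<in>I +> x. I +> (r \<otimes> y)) = (\<Union>y\<in>I +> x. I +> (r \<otimes> x))"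
    by (rule SUP_cong[OF refl])
  also have "\<dots> = I +> (r \<otimes> x)"
    using I.a_rcos_self[OF assms(2)] by (intro SUP_const) blast
  finally show ?thesis
    by (simp add: left_quotient_def)
qed

lemma left_module_left_quotient: "left_module R (left_quotient I)"
proof (intro left_module.intro left_module_axioms.intro)
  note * = a_rcosets_iff
  note s = smult_left_quotient I.a_rcos_sum I.a_rcos_const[OF I.zero_closed]
  show "abelian_group (left_quotient I)"
  proof (rule abelian_groupI)
    fix X assume "X \<in> carrier (left_quotient I)"
    then obtain x where x: "x \<in> carrier R" "X = I +> x" by (auto simp: *)
    then show "\<exists>Y\<in>carrier (left_quotient I). Y \<oplus>\<^bsub>left_quotient I\<^esub> X = \<zero>\<^bsub>left_quotient I\<^esub>"
      by (intro bexI[of _ "I +> (\<ominus> x)"]) (auto simp: * s l_neg)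
    show "\<zero>\<^bsub>left_quotient I\<^esub> \<oplus>\<^bsub>left_quotient I\<^esub> X = X"
      using I.rcosets_add_eq \<open>X \<in> carrier (left_quotient I)\<close> by simp
  qed (auto simp: * s a_ac I.a_subgroup_in_rcosets[unfolded *])
  show "ring R" by (rule ring_axioms)
qed (auto simp: a_rcosets_iff smult_left_quotient I.a_rcos_sum l_distr r_distr m_assoc)

text \<open>
  The balanced map \<open>P \<times> R/I \<rightarrow> R/K\<close>, \<open>(p, x + I) \<mapsto> px + K\<close> is not formed as such: choosing
  representatives gives a homomorphism from the free group to \<open>R\<close> that sends the relators into \<open>K\<close>.
\<close>

lemma pure_right_ideal_inter_subset:
  assumes P: "pure_submodule R P (right_regular R)"
    and K: "additive_subgroup K R" "\<And>p i. p \<in> P \<Longrightarrow> i \<in> I \<Longrightarrow> p \<otimes> i \<in> K"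
  shows "P \<inter> I \<subseteq> K"
proof
  fix a assume a: "a \<in> P \<inter> I"
  let ?M = "right_regular R" and ?N = "left_quotient I"
  let ?P = "?M\<lparr>carrier := P\<rparr>"
  interpret K: additive_subgroup K R by fact
  note M = right_module_right_regular and N = left_module_left_quotient
  \<comment> \<open>The elements of \<open>R/I\<close> are sets of ring elements, so purity is
    transferred to the type \<open>'a set\<close>.\<close>
  have pure: "pure_submodule_wrt TYPE('a set) R P ?M"
    by (rule pure_submodule_imp_wrt[OF M P])
  then have sub: "submodule P R ?M"
    by (simp add: pure_submodule_wrt_def)
  note sP = submodule_right_regularD[OF sub]
  have aR: "a \<in> carrier R" using a sP(1) by auto
  note P' = right_module_submodule[OF M sub]
  let ?x = "frag_of (a, I +> \<one>) :: 'a \<times> 'a set \<Rightarrow>\<^sub>0 int"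
  have cos: "I +> x \<in> a_rcosets I" if "x \<in> carrier R" for x
    using that by (auto simp: a_rcosets_iff)
  \<comment> \<open>In the tensor product of \<open>R\<close> and \<open>R/I\<close>, the class of
    \<open>?x\<close> is that of \<open>\<one>\<close> tensored with \<open>a(1 + I)\<close>. Since
    \<open>a\<close> lies in \<open>I\<close>, the second factor is the zero coset, and the class
    vanishes.\<close>
  have "?x \<in> tensor_rel R ?M ?N"
  proof -
    interpret T: subgroup "tensor_rel R ?M ?N" "tensor_free ?M ?N"
      by (rule tensor_rel_subgroup[OF M N])
    have inc: "tensor_relators R ?M ?N \<subseteq> tensor_rel R ?M ?N"
      unfolding tensor_rel_def by (auto intro: generate.incl)
    have "I +> a = I"
      using a I.a_rcos_const by simp
    then have aX: "a \<odot>\<^bsub>?N\<^esub> (I +> \<one>) = I"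
      using aR by (simp add: smult_left_quotient)
    have "?x - frag_of (\<one>, I) \<in> tensor_relators R ?M ?N"
      unfolding tensor_relators_def
      by (rule UnI2, rule CollectI, rule exI[of _ a], rule exI[of _ \<one>], rule exI[of _ "I +> \<one>"])
        (use aR in \<open>simp add: aX cos\<close>)
    \<comment> \<open>Additivity in the second argument for the zero coset \<open>I\<close> added to
      itself: one copy of the generator cancels and a single negative copy remains.\<close>
    moreover have "- frag_of (\<one>, I) \<in> tensor_relators R ?M ?N"
      unfolding tensor_relators_def
      by (rule UnI1, rule UnI2, rule CollectI, rule exI[of _ \<one>], rule exI[of _ I], rule exI[of _ I])
        (simp add: I.a_subgroup_in_rcosets I.rcosets_add_eq)
    ultimately have 1: "?x - frag_of (\<one>, I) \<in> tensor_rel R ?M ?N"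
      and 2: "- frag_of (\<one>, I) \<in> tensor_rel R ?M ?N"
      using inc by auto
    show ?thesis
      using T.m_closed[OF 1 T.m_inv_closed[OF 2]] I.a_subgroup_in_rcosets by simp
  qed
  moreover have "Poly_Mapping.keys ?x \<subseteq> carrier ?P \<times> carrier ?N"
    using a cos by simp
  moreover have "inj_on (tensor_map R ?M ?N (\<lambda>x. x)) (carrier (tensor_product R ?P ?N))"
    using pure N by (simp add: pure_submodule_wrt_def)
  \<comment> \<open>Injectivity moves the vanishing of \<open>?x\<close> down to the tensor product
    with \<open>P\<close>.\<close>
  ultimately have x: "?x \<in> tensor_rel R ?P ?N"
    using sP(1) by (subst (asm) inj_on_tensor_map_iff[OF P' M N]) auto
  define rep where "rep X = (SOME x. x \<in> carrier R \<and> X = I +> x)" for X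
  have rep: "rep X \<in> carrier R \<and> X = I +> rep X" if "X \<in> a_rcosets I" for X
    unfolding rep_def by (rule someI_ex) (use that in \<open>auto simp: a_rcosets_iff\<close>)
  \<comment> \<open>Since products of \<open>P\<close> with \<open>I\<close> lie in
    \<open>K\<close>, the arbitrary choice made by \<open>rep\<close> does not matter modulo
    \<open>K\<close>.\<close>
  have K': "p \<otimes> x \<ominus> p \<otimes> y \<in> K"
    if "p \<in> P" "x \<in> carrier R" "y \<in> carrier R" "I +> x = I +> y" for p x y
  proof -
    have "x \<ominus> y \<in> I"
      using that I.a_rcos_module_minus[OF ring_axioms, of y x] I.a_rcos_self by auto
    moreover have "p \<otimes> (x \<ominus> y) = p \<otimes> x \<ominus> p \<otimes> y"
      using that sP(1) by (auto simp: minus_eq r_distr r_minus)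
    ultimately show ?thesis
      using K(2)[OF that(1)] by metis
  qed
  obtain h where h: "h \<in> hom (tensor_free ?P ?N) (add_monoid R)"
    and hf: "\<And>z. z \<in> carrier ?P \<times> carrier ?N \<Longrightarrow> h (frag_of z) = (\<lambda>(p, X). p \<otimes> rep X) z"
    by (rule comm_group.free_Abelian_group_universal[OF a_comm_group,
          of "\<lambda>(p, X). p \<otimes> rep X" "carrier ?P \<times> carrier ?N"])
      (use sP(1) rep in \<open>auto simp: subset_iff\<close>)
  interpret h: group_hom "tensor_free ?P ?N" "add_monoid R" h
    by (intro group_hom.intro group_hom_axioms.intro a_group h) simp
  have hd: "h (u - v) = h u \<ominus> h v"
    if "Poly_Mapping.keys u \<subseteq> P \<times> a_rcosets I" "Poly_Mapping.keys v \<subseteq> P \<times> a_rcosets I" for u v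
    using that h.hom_mult[of u "- v"] h.hom_inv[of v] by (simp add: minus_eq a_inv_def)
  have kd: "Poly_Mapping.keys (u - v) \<subseteq> P \<times> a_rcosets I"
    if "Poly_Mapping.keys u \<subseteq> P \<times> a_rcosets I" "Poly_Mapping.keys v \<subseteq> P \<times> a_rcosets I"
    for u v :: "'a \<times> 'a set \<Rightarrow>\<^sub>0 int"
    using that keys_diff[of u v] by blast
  interpret N: left_module R ?N by (rule N)
  note Nc = N.M.a_closed[simplified] N.smult_closed[simplified]
  \<comment> \<open>Additivity in the first argument involves one coset, hence one representative,
    and gives exactly zero. The other two kinds of relator compare different representatives of the
    same coset, which is the situation of \<open>K'\<close>.\<close>
  have rel: "h r \<in> K" if "r \<in> tensor_relators R ?P ?N" for r
    using that unfolding tensor_relators_def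
  proof (elim UnE CollectE exE conjE)
    fix p q X assume r: "r = frag_of (p \<oplus>\<^bsub>?P\<^esub> q, X) - frag_of (p, X) - frag_of (q, X)"
      and c: "p \<in> carrier ?P" "q \<in> carrier ?P" "X \<in> carrier ?N"
    then have car: "p \<in> carrier R" "q \<in> carrier R" "rep X \<in> carrier R"
      using sP(1) rep by auto
    have "h r = (p \<oplus> q) \<otimes> rep X \<ominus> p \<otimes> rep X \<ominus> q \<otimes> rep X"
      using r c sP(3) by (simp add: hd kd hf)
    also have "\<dots> = (p \<oplus> q) \<otimes> rep X \<ominus> (p \<oplus> q) \<otimes> rep X"
      using car by (simp add: l_distr minus_eq minus_add a_ac)
    also have "\<dots> = \<zero>"
      using car by (simp add: minus_eq r_neg)
    finally show ?thesis by simp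
  next
    fix p X Y assume r: "r = frag_of (p, X \<oplus>\<^bsub>?N\<^esub> Y) - frag_of (p, X) - frag_of (p, Y)"
      and c: "p \<in> carrier ?P" "X \<in> carrier ?N" "Y \<in> carrier ?N"
    then have XY: "X <+>\<^bsub>R\<^esub> Y \<in> a_rcosets I" using Nc(1) by simp
    have car: "p \<in> carrier R" "rep X \<in> carrier R" "rep Y \<in> carrier R" "rep (X <+>\<^bsub>R\<^esub> Y) \<in> carrier R"
      using c sP(1) rep XY by auto
    have "h r = p \<otimes> rep (X <+>\<^bsub>R\<^esub> Y) \<ominus> p \<otimes> rep X \<ominus> p \<otimes> rep Y"
      using r c XY by (simp add: hd kd hf)
    also have "\<dots> = p \<otimes> rep (X <+>\<^bsub>R\<^esub> Y) \<ominus> p \<otimes> (rep X \<oplus> rep Y)"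
      using car by (simp add: minus_eq r_distr minus_add a_ac)
    also have "\<dots> \<in> K"
    proof (rule K')
      have "X <+>\<^bsub>R\<^esub> Y = (I +> rep X) <+>\<^bsub>R\<^esub> (I +> rep Y)"
        using rep c by simp
      also have "\<dots> = I +> (rep X \<oplus> rep Y)"
        using car by (simp add: I.a_rcos_sum)
      finally show "I +> rep (X <+>\<^bsub>R\<^esub> Y) = I +> (rep X \<oplus> rep Y)"
        using rep[OF XY] by simp
    qed (use c car in auto)
    finally show ?thesis .
  next
    fix b p X assume r: "r = frag_of (b \<odot>\<^bsub>?P\<^esub> p, X) - frag_of (p, b \<odot>\<^bsub>?N\<^esub> X)"
      and c: "b \<in> carrier R" "p \<in> carrier ?P" "X \<in> carrier ?N"
    then have bX: "b \<odot>\<^bsub>?N\<^esub> X \<in> a_rcosets I" using Nc(2) by simp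
    have car: "p \<in> carrier R" "rep X \<in> carrier R" "rep (b \<odot>\<^bsub>?N\<^esub> X) \<in> carrier R"
      using c sP(1) rep bX by auto
    have "h r = p \<otimes> b \<otimes> rep X \<ominus> p \<otimes> rep (b \<odot>\<^bsub>?N\<^esub> X)"
      using r c bX sP(4) by (simp add: hd kd hf)
    also have "\<dots> = p \<otimes> (b \<otimes> rep X) \<ominus> p \<otimes> rep (b \<odot>\<^bsub>?N\<^esub> X)"
      using car c by (simp add: m_assoc)
    also have "\<dots> \<in> K"
    proof (rule K')
      have "b \<odot>\<^bsub>?N\<^esub> X = b \<odot>\<^bsub>?N\<^esub> (I +> rep X)"
        using rep c by simp
      also have "\<dots> = I +> (b \<otimes> rep X)"
        using car c by (simp add: smult_left_quotient)
      finally show "I +> (b \<otimes> rep X) = I +> rep (b \<odot>\<^bsub>?N\<^esub> X)"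
        using rep[OF bX] by simp
    qed (use c car in auto)
    finally show ?thesis .
  qed
  have hK: "h z \<in> K" if "z \<in> tensor_rel R ?P ?N" for z
    using that unfolding tensor_rel_def
  proof (induction rule: generate.induct)
    case one
    then show ?case using h.hom_one by simp
  next
    case (inv z)
    then have "z \<in> carrier (tensor_free ?P ?N)"
      using tensor_relators_subset[OF P' N] by blast
    then show ?case
      using h.hom_inv[of z] rel[OF inv] by (simp flip: a_inv_def)
  next
    case (eng z1 z2)
    have "z1 \<in> carrier (tensor_free ?P ?N)" "z2 \<in> carrier (tensor_free ?P ?N)"
      using eng.hyps subgroup.mem_carrier[OF tensor_rel_subgroup[OF P' N]]
      unfolding tensor_rel_def by auto
    then show ?case
      using h.hom_mult[of z1 z2] eng.IH by simp
  qed (rule rel)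
  have "a \<otimes> rep (I +> \<one>) \<in> K"
    using hK[OF x] a cos[OF one_closed] by (simp add: hf)
  \<comment> \<open>\<open>rep (I +> \<one>)\<close> may differ from \<open>\<one>\<close>; this
    difference lies in \<open>K\<close> and is added back to recover \<open>a\<close>.\<close>
  moreover have "a \<otimes> \<one> \<ominus> a \<otimes> rep (I +> \<one>) \<in> K"
    using a rep[OF cos[OF one_closed]] by (intro K') auto
  ultimately have "(a \<otimes> \<one> \<ominus> a \<otimes> rep (I +> \<one>)) \<oplus> a \<otimes> rep (I +> \<one>) \<in> K"
    by (rule K.a_closed[rotated])
  then show "a \<in> K"
    using aR rep[OF cos[OF one_closed]] by (simp add: minus_eq a_assoc l_neg)
qed

end

section \<open>Local units in pure right ideals\<close>

text \<open>Serves for both \<open>Ra\<close> and \<open>Pa\<close>, with \<open>H\<close> the whole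
  ring or the right ideal \<open>P\<close>.\<close>

lemma additive_subgroup_mult_right:
  assumes "H \<subseteq> carrier R" "\<zero> \<in> H" "\<And>x y. x \<in> H \<Longrightarrow> y \<in> H \<Longrightarrow> x \<ominus> y \<in> H" "a \<in> carrier R"
  shows "additive_subgroup ((\<lambda>x. x \<otimes> a) ` H) R"
proof (rule additive_subgroupI_minus)
  show "(\<lambda>x. x \<otimes> a) ` H \<subseteq> carrier R"
    using assms by auto
  show "\<zero> \<in> (\<lambda>x. x \<otimes> a) ` H"
    using assms by (intro image_eqI[of _ _ \<zero>]) auto
  fix u v assume "u \<in> (\<lambda>x. x \<otimes> a) ` H" "v \<in> (\<lambda>x. x \<otimes> a) ` H"
  then obtain x y where *: "x \<in> H" "u = x \<otimes> a" "y \<in> H" "v = y \<otimes> a" by auto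
  then have "u \<ominus> v = (x \<ominus> y) \<otimes> a"
    using assms(1,4) by (auto simp: minus_eq l_distr l_minus subset_iff)
  then show "u \<ominus> v \<in> (\<lambda>x. x \<otimes> a) ` H"
    using assms(3) * by auto
qed

text \<open>Take \<open>I = Ra\<close> and \<open>K = Pa\<close> in
  \<open>pure_right_ideal_inter_subset\<close>. The products of \<open>P\<close> with
  \<open>Ra\<close> fall into \<open>Pa\<close> because \<open>P\<close> absorbs right
  multiplication, and \<open>a\<close> lies in both \<open>P\<close> and \<open>Ra\<close>.\<close>

lemma pure_right_ideal_local_unit:
  assumes P: "pure_submodule R P (right_regular R)" and a: "a \<in> P"
  shows "\<exists>p\<in>P. a = p \<otimes> a"
proof -
  have sub: "submodule P R (right_regular R)"
    using P by (simp add: pure_submodule_def pure_submodule_wrt_def)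
  note sP = submodule_right_regularD[OF sub]
  have aR: "a \<in> carrier R" using a sP(1) by auto
  have m: "x \<ominus> y \<in> P" if "x \<in> P" "y \<in> P" for x y
  proof -
    have "x \<ominus> y = x \<oplus> y \<otimes> (\<ominus> \<one>)"
      using that sP(1) by (auto simp: minus_eq r_minus)
    then show ?thesis
      using sP(3)[OF that(1) sP(4)[OF that(2)]] by simp
  qed
  have "P \<inter> (\<lambda>r. r \<otimes> a) ` carrier R \<subseteq> (\<lambda>p. p \<otimes> a) ` P"
  proof (rule pure_right_ideal_inter_subset[OF _ _ P])
    fix r i assume "r \<in> carrier R" "i \<in> (\<lambda>r. r \<otimes> a) ` carrier R"
    then show "r \<otimes> i \<in> (\<lambda>r. r \<otimes> a) ` carrier R"
      using aR by (auto simp flip: m_assoc)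
  next
    fix p i assume "p \<in> P" "i \<in> (\<lambda>r. r \<otimes> a) ` carrier R"
    then show "p \<otimes> i \<in> (\<lambda>p. p \<otimes> a) ` P"
      using aR sP by (auto simp: subset_iff simp flip: m_assoc)
  qed (use sP m aR in \<open>auto intro!: additive_subgroup_mult_right\<close>)
  moreover have "a \<in> (\<lambda>r. r \<otimes> a) ` carrier R"
    using aR by (intro image_eqI[of _ _ \<one>]) auto
  ultimately show ?thesis using a by blast
qed

section \<open>Invertibility outside the unique maximal right ideal\<close>

text \<open>If the right ideal \<open>xR\<close> were proper, it would lie in a maximal right ideal,
  which can only be \<open>J\<close>; but it contains \<open>x\<close>.\<close>

lemma exists_right_inverse:
  assumes J: "maximal_right_ideal J R" "\<And>J'. maximal_right_ideal J' R \<Longrightarrow> J' = J"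
    and x: "x \<in> carrier R" "x \<notin> J"
  shows "\<exists>y\<in>carrier R. x \<otimes> y = \<one>"
proof -
  let ?K = "(\<lambda>y. x \<otimes> y) ` carrier R"
  have K: "submodule ?K R (right_regular R)"
  proof (rule submodule_right_regularI)
    show "\<zero> \<in> ?K"
      using x by (intro image_eqI[of _ _ \<zero>]) auto
    show "u \<oplus> v \<in> ?K" if "u \<in> ?K" "v \<in> ?K" for u v
      using that x by (auto simp flip: r_distr)
  qed (use x in \<open>auto simp: m_assoc\<close>)
  have "x \<in> ?K"
    using x by (intro image_eqI[of _ _ \<one>]) auto
  then have "?K = carrier R"
    using exists_maximal_right_ideal[OF K] J(2) x(2) by blast
  then show ?thesis
    using one_closed by (metis (no_types, lifting) imageE)
qed

text \<open>Cancelling \<open>\<one> \<ominus> p\<close> from the left needs a left inverse, while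
  \<open>exists_right_inverse\<close> gives right inverses only. Applying it twice, first to
  \<open>\<one> \<ominus> p\<close> and then to the inverse \<open>q\<close>, makes \<open>q\<close>
  two-sided.\<close>

lemma eq_mult_maximal_right_ideal_imp_zero:
  assumes J: "maximal_right_ideal J R" "\<And>J'. maximal_right_ideal J' R \<Longrightarrow> J' = J"
    and p: "p \<in> J" and a: "a \<in> carrier R" "a = p \<otimes> a"
  shows "a = \<zero>"
proof -
  have sub: "submodule J R (right_regular R)" and ne: "J \<noteq> carrier R"
    using J(1) by (auto simp: maximal_right_ideal_def)
  note sJ = submodule_right_regularD[OF sub]
  have one: "\<one> \<notin> J"
    using submodule_right_regular_eq_carrier[OF sub] ne by blast
  have pR: "p \<in> carrier R" using p sJ(1) by auto
  have "\<one> \<ominus> p \<notin> J"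
  proof
    assume "\<one> \<ominus> p \<in> J"
    from sJ(3)[OF this p] show False
      using one pR by (simp add: minus_eq a_assoc l_neg)
  qed
  then obtain q where q: "q \<in> carrier R" "(\<one> \<ominus> p) \<otimes> q = \<one>"
    using exists_right_inverse[OF J, of "\<one> \<ominus> p"] pR minus_closed one_closed by blast
  have "q \<ominus> p \<otimes> q = \<one>"
    using q pR by (simp add: minus_eq l_distr l_minus)
  then have q': "q = \<one> \<oplus> p \<otimes> q"
    using q(1) pR by (metis a_assoc l_neg m_closed minus_eq a_inv_closed r_zero)
  \<comment> \<open>\<open>J\<close> contains \<open>p \<otimes> q\<close>, so \<open>q\<close> in
    \<open>J\<close> would put \<open>q \<ominus> p \<otimes> q = \<one>\<close> there.\<close>
  have "q \<notin> J"
  proof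
    assume "q \<in> J"
    moreover have "p \<otimes> q \<otimes> (\<ominus> \<one>) \<in> J"
      using sJ(4) p q(1) by simp
    ultimately have "q \<oplus> p \<otimes> q \<otimes> (\<ominus> \<one>) \<in> J"
      by (rule sJ(3))
    then show False
      using \<open>q \<ominus> p \<otimes> q = \<one>\<close> one q(1) pR by (simp add: minus_eq r_minus)
  qed
  then obtain s where s: "s \<in> carrier R" "q \<otimes> s = \<one>"
    using exists_right_inverse[OF J q(1)] by auto
  \<comment> \<open>Both equal \<open>(\<one> \<ominus> p) \<otimes> q \<otimes> s\<close>: a left
    and a right inverse of \<open>q\<close> agree.\<close>
  have "\<one> \<ominus> p = s"
    using q s pR by (metis l_one m_assoc minus_closed one_closed r_one)
  then have "q \<otimes> (\<one> \<ominus> p) = \<one>"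
    using s by simp
  moreover have "(\<one> \<ominus> p) \<otimes> a = \<zero>"
  proof -
    have "(\<one> \<ominus> p) \<otimes> a = a \<ominus> p \<otimes> a"
      using pR a(1) by (simp add: minus_eq l_distr l_minus)
    then show ?thesis
      using a by (simp add: minus_eq r_neg)
  qed
  ultimately show ?thesis
    using q(1) pR a(1) by (metis l_one m_assoc minus_closed one_closed r_null)
qed

end

section \<open>Pure right ideals of a local ring\<close>

lemma local_ring_pure_right_ideal:
  assumes R: "local_ring R" and P: "pure_submodule R P (right_regular R)"
  shows "P = {\<zero>\<^bsub>R\<^esub>} \<or> P = carrier R"
proof (rule disjCI)
  interpret ring R using R by (simp add: local_ring_def)
  have sub: "submodule P R (right_regular R)"
    using P by (simp add: pure_submodule_def pure_submodule_wrt_def)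
  note sP = submodule_right_regularD[OF sub]
  assume "P \<noteq> carrier R"
  then obtain J where J: "maximal_right_ideal J R" "P \<subseteq> J"
    using exists_maximal_right_ideal[OF sub] by blast
  have "a = \<zero>\<^bsub>R\<^esub>" if a: "a \<in> P" for a
  proof -
    obtain p where "p \<in> P" "a = p \<otimes>\<^bsub>R\<^esub> a"
      using pure_right_ideal_local_unit[OF P a] by blast
    then show ?thesis
      using eq_mult_maximal_right_ideal_imp_zero[OF J(1)] J R a sP(1)
      unfolding local_ring_def by blast
  qed
  then show "P = {\<zero>\<^bsub>R\<^esub>}"
    using sP(2) by blast
qed

theorem proposition29:
  fixes R :: "('a, 'c) ring_scheme"
  assumes "local_ring R"
  shows "pure_extending R (right_regular R)"
proof -
  interpret ring R using assms by (simp add: local_ring_def)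
  let ?M = "right_regular R"
  have zero: "submodule {\<zero>\<^bsub>R\<^esub>} R ?M" and all: "submodule (carrier R) R ?M"
    by (auto intro!: submodule_right_regularI)
  have "{\<zero>\<^bsub>R\<^esub>} <+>\<^bsub>?M\<^esub> carrier R = carrier R" "carrier R <+>\<^bsub>?M\<^esub> {\<zero>\<^bsub>R\<^esub>} = carrier R"
    by (auto simp: set_add_def set_mult_def)
  \<comment> \<open>The zero ideal and the whole ring are complements of each other.\<close>
  then have "direct_summand R {\<zero>\<^bsub>R\<^esub>} ?M" "direct_summand R (carrier R) ?M"
    unfolding direct_summand_def using zero all
    by (fastforce intro: exI[of _ "carrier R"], fastforce intro: exI[of _ "{\<zero>\<^bsub>R\<^esub>}"])
  \<comment> \<open>The summand \<open>D\<close> will be \<open>P\<close> itself: a submodule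
    \<open>X\<close> of \<open>P\<close> meets \<open>P\<close> in \<open>X\<close>, so
    \<open>P\<close> is essential in \<open>P\<close>.\<close>
  moreover have "essential_submodule R P (?M\<lparr>carrier := P\<rparr>)" if P: "submodule P R ?M" for P
  proof -
    interpret M: right_module R ?M by (rule right_module_right_regular)
    interpret P: submodule P R ?M by fact
    have "X \<subseteq> P" if "submodule X R (?M\<lparr>carrier := P\<rparr>)" for X
      using subgroup.subset[OF submodule.axioms(1)[OF that]] by simp
    moreover have "submodule P R (?M\<lparr>carrier := P\<rparr>)"
      using M.M.add.subgroup_incl[OF P.subgroup_axioms P.subgroup_axioms] P.smult_closed
      by (intro submodule.intro submodule_axioms.intro) auto
    ultimately show ?thesis
      unfolding essential_submodule_def by (auto simp: Int_absorb1)
  qed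
  ultimately have "\<exists>D. direct_summand R D ?M \<and> essential_submodule R P (?M\<lparr>carrier := D\<rparr>)"
    if "pure_submodule R P ?M" for P
    using local_ring_pure_right_ideal[OF assms that] zero all by blast
  then show ?thesis
    unfolding pure_extending_def using right_module_right_regular by blast
qed

end
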